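(* A metric space $(X,\mathrm{dist})$ is submedian if and only if it admits a structure of space with measured walls $(X,\mathcal{W},\mathcal{B},\mu)$ such that $\mathrm{dist}=\mathrm{dist}_\mu$, where $\mathrm{dist}_\mu(x,y)=\mu(\mathcal{W}(x|y))$. Moreover, all walls in $\mathcal{W}$ may be assumed to be convex.
   Context: In a metric space, $I(a,b)=\{x\; ;\; \mathrm{dist}(a,x)+\mathrm{dist}(x,b)=\mathrm{dist}(a,b)\}$. A median space is a metric space in which $I(a,b)\cap I(b,c)\cap I(a,c)$ is a single point for all $a,b,c$. A metric space is submedian if it admits an isometric embedding into a median space. A subset $A$ of a metric space is convex if $I(a,b)\subset A$ for all $a,b\in A$. A wall of a set $X$ is a partition $X=h\sqcup h^c$ ($h$ possibly empty or all of $X$), identified with the pair $\{h,h^c\}$; it is convex if $h$ and $h^c$ are both convex. For a collection $\mathcal{W}$ of walls, $\mathcal{W}(x|y)$ is the set of walls $\{h,h^c\}\in\mathcal{W}$ such that one of $x,y$ is in $h$ and the other in $h^c$. A space with measured walls is a 4-tuple $(X,\mathcal{W},\mathcal{B},\mu)$ where $\mathcal{W}$ is a collection of walls on $X$, $\mathcal{B}$ is a $\sigma$-algebra on $\mathcal{W}$ and $\mu$ is a measure on $\mathcal{B}$ such that for all $x,y\in X$, $\mathcal{W}(x|y)\in\mathcal{B}$ and $\mu(\mathcal{W}(x|y))<\infty$. *)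

theory Defs
  imports "HOL-Analysis.Analysis"
begin

section \<open>Median and submedian metric spaces\<close>

definition metric_interval :: "'a metric \<Rightarrow> 'a \<Rightarrow> 'a \<Rightarrow> 'a set" where
  "metric_interval X a b = {x \<in> mspace X. mdist X a x + mdist X x b = mdist X a b}"

definition median_space :: "'a metric \<Rightarrow> bool" where
  "median_space X \<longleftrightarrow>
     (\<forall>a \<in> mspace X. \<forall>b \<in> mspace X. \<forall>c \<in> mspace X.
        \<exists>m. metric_interval X a b \<inter> metric_interval X b c \<inter> metric_interval X a c = {m})"

definition metric_convex :: "'a metric \<Rightarrow> 'a set \<Rightarrow> bool" where
  "metric_convex X A \<longleftrightarrow>
     A \<subseteq> mspace X \<and> (\<forall>a \<in> A. \<forall>b \<in> A. metric_interval X a b \<subseteq> A)"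

definition isometric_embedding :: "'a metric \<Rightarrow> 'b metric \<Rightarrow> ('a \<Rightarrow> 'b) \<Rightarrow> bool" where
  "isometric_embedding X Y f \<longleftrightarrow>
     f \<in> mspace X \<rightarrow> mspace Y \<and>
     (\<forall>x \<in> mspace X. \<forall>y \<in> mspace X. mdist Y (f x) (f y) = mdist X x y)"

text \<open>
  HOL cannot quantify existentially over types, so the carrier of the ambient median space in
  \<open>submedian\<close> has to be a subset of a fixed type. Formal ternary terms over \<open>'a\<close> suffice: if a space
  embeds isometrically into any median space, over any type, then it embeds into the median
  subspace generated by its image, each point of which is the value of such a term. The lemma
  \<open>submedianI_any_type\<close> below proves that the choice of type is therefore no restriction.
\<close>

datatype 'a median_term = Point 'a | Med "'a median_term" "'a median_term" "'a median_term"

definition submedian :: "'a metric \<Rightarrow> bool" where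
  "submedian X \<longleftrightarrow>
     (\<exists>(Y :: 'a median_term metric) f. median_space Y \<and> isometric_embedding X Y f)"

lemma submedianI_any_type:
  fixes X :: "'a metric" and Y :: "'b metric"
  assumes med: "median_space Y" and emb: "isometric_embedding X Y f"
  shows "submedian X"
proof -
  define I where "I a b c =
    metric_interval Y a b \<inter> metric_interval Y b c \<inter> metric_interval Y a c" for a b c
  define m where "m a b c = (THE p. I a b c = {p})" for a b c
  have m: "I a b c = {m a b c}" if "a \<in> mspace Y" "b \<in> mspace Y" "c \<in> mspace Y" for a b c
  proof -
    have "\<exists>p. I a b c = {p}"
      using med[unfolded median_space_def, rule_format, OF that] by (simp only: I_def)
    then obtain p where p: "I a b c = {p}" ..
    then have "m a b c = p" unfolding m_def by auto
    with p show ?thesis by simp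
  qed
  have mY: "m a b c \<in> mspace Y" if "a \<in> mspace Y" "b \<in> mspace Y" "c \<in> mspace Y" for a b c
  proof -
    have "m a b c \<in> I a b c" using m[OF that] by simp
    then show ?thesis by (simp add: I_def metric_interval_def)
  qed
  define ev where "ev = rec_median_term f (\<lambda>_ _ _ a b c. m a b c)"
  have ev_simps [simp]: "ev (Point x) = f x" "ev (Med r s t) = m (ev r) (ev s) (ev t)"
    for x r s t by (simp_all add: ev_def)
  define T where "T = {t. set_median_term t \<subseteq> mspace X}"
  have evY: "ev t \<in> mspace Y" if "t \<in> T" for t
    using that
  proof (induction t)
    case (Point x)
    then show ?case using emb by (auto simp: T_def isometric_embedding_def)
  next
    case (Med r s t)
    then show ?case by (simp add: T_def mY)
  qed
  define H where "H = ev ` T"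
  define g where "g = inv_into T ev"
  have evg: "ev (g h) = h" if "h \<in> H" for h
    using that unfolding H_def g_def by (rule f_inv_into_f)
  have HY: "H \<subseteq> mspace Y" using evY by (auto simp: H_def)
  have Hm: "m a b c \<in> H" if abc: "a \<in> H" "b \<in> H" "c \<in> H" for a b c
  proof -
    obtain r s t where *: "r \<in> T" "s \<in> T" "t \<in> T" "a = ev r" "b = ev s" "c = ev t"
      using abc by (auto simp: H_def)
    then have "Med r s t \<in> T" by (simp add: T_def)
    moreover have "m a b c = ev (Med r s t)" using * by simp
    ultimately show ?thesis unfolding H_def by blast
  qed
  have Hf: "f x \<in> H" if "x \<in> mspace X" for x
  proof -
    have "Point x \<in> T" using that by (simp add: T_def)
    then show ?thesis unfolding H_def by (metis ev_simps(1) image_eqI)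
  qed
  define d where "d s t = mdist Y (ev s) (ev t)" for s t
  have MS: "Metric_space (g ` H) d"
  proof
    fix s t u
    show "0 \<le> d s t" by (simp add: d_def)
    show "d s t = d t s" by (simp add: d_def mdist_commute)
    show "d s t = 0 \<longleftrightarrow> s = t" if "s \<in> g ` H" "t \<in> g ` H"
      using that HY evg by (auto simp: d_def subset_iff)
    show "d s u \<le> d s t + d t u" if "s \<in> g ` H" "t \<in> g ` H" "u \<in> g ` H"
      using that HY evg by (auto simp: d_def subset_iff intro!: mdist_triangle)
  qed
  define Z where "Z = metric (g ` H, d)"
  have Zs: "mspace Z = g ` H" and Zd: "mdist Z = d"
    using MS by (simp_all add: Z_def Metric_space.mspace_metric Metric_space.mdist_metric)
  have int: "metric_interval Z (g a) (g b) = g ` (metric_interval Y a b \<inter> H)"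
    if "a \<in> H" "b \<in> H" for a b
    using that HY by (auto simp: metric_interval_def Zs Zd d_def evg)
  have injg: "inj_on g H" using evg by (metis inj_onI)
  have "median_space Z"
    unfolding median_space_def
  proof (intro ballI)
    fix a' b' c' assume "a' \<in> mspace Z" "b' \<in> mspace Z" "c' \<in> mspace Z"
    then obtain a b c where abc: "a \<in> H" "b \<in> H" "c \<in> H" "a' = g a" "b' = g b" "c' = g c"
      by (auto simp: Zs)
    have "metric_interval Z a' b' \<inter> metric_interval Z b' c' \<inter> metric_interval Z a' c'
      = g ` (metric_interval Y a b \<inter> H) \<inter> g ` (metric_interval Y b c \<inter> H)
        \<inter> g ` (metric_interval Y a c \<inter> H)"
      using abc int by simp
    also have "\<dots> = g ` (I a b c \<inter> H)"
      unfolding I_def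
      by (subst inj_on_image_Int[OF injg, symmetric], blast, blast)+ (simp add: Int_ac)
    also have "I a b c = {m a b c}" using m abc HY by blast
    also have "g ` ({m a b c} \<inter> H) = {g (m a b c)}" using Hm abc by auto
    finally show "\<exists>p. metric_interval Z a' b' \<inter> metric_interval Z b' c'
        \<inter> metric_interval Z a' c' = {p}" by blast
  qed
  moreover have "isometric_embedding X Z (g \<circ> f)"
    using emb Hf evg by (auto simp: isometric_embedding_def Zs Zd d_def)
  ultimately show ?thesis unfolding submedian_def by blast
qed


section \<open>Spaces with measured walls\<close>

definition walls :: "'a set \<Rightarrow> 'a set set set" where
  "walls S = {{h, S - h} | h. h \<subseteq> S}"

definition separating :: "'a set \<Rightarrow> 'a set set set \<Rightarrow> 'a \<Rightarrow> 'a \<Rightarrow> 'a set set set" where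
  "separating S W x y =
     {w \<in> W. \<exists>h \<subseteq> S. w = {h, S - h} \<and> (x \<in> h \<and> y \<in> S - h \<or> y \<in> h \<and> x \<in> S - h)}"

definition convex_wall :: "'a metric \<Rightarrow> 'a set set \<Rightarrow> bool" where
  "convex_wall X w \<longleftrightarrow>
     (\<exists>h \<subseteq> mspace X. w = {h, mspace X - h} \<and>
        metric_convex X h \<and> metric_convex X (mspace X - h))"

text \<open>
  The triple \<open>(\<W>, \<B>, \<mu>)\<close> of a space with measured walls is a single value \<open>M\<close> of type \<open>measure\<close>:
  \<open>\<W> = space M\<close>, \<open>\<B> = sets M\<close>, \<open>\<mu> = emeasure M\<close>.
\<close>

definition measured_walls :: "'a set \<Rightarrow> 'a set set measure \<Rightarrow> bool" where
  "measured_walls S M \<longleftrightarrow>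
     space M \<subseteq> walls S \<and>
     (\<forall>x \<in> S. \<forall>y \<in> S. separating S (space M) x y \<in> sets M \<and>
        emeasure M (separating S (space M) x y) < \<infinity>)"

definition wall_dist :: "'a set \<Rightarrow> 'a set set measure \<Rightarrow> 'a \<Rightarrow> 'a \<Rightarrow> real" where
  "wall_dist S M x y = measure M (separating S (space M) x y)"

end

theory Submission
  imports Defs
begin

text \<open>
  From walls to medians: in any measure space the sets of finite measure, modulo null sets, form a
  median space for the distance \<open>measure M (sym_diff A B)\<close>, the median of three sets being the set
  of points lying in at least two of them. If \<open>dist(x, y)\<close> is the measure of the set \<open>W(x|y)\<close> of
  walls separating \<open>x\<close> from \<open>y\<close>, then \<open>x \<mapsto> W(x0|x)\<close> is an isometric embedding into that space,
  because \<open>W(x0|x)\<close> and \<open>W(x0|y)\<close> have symmetric difference \<open>W(x|y)\<close>.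

  From medians to walls: let \<open>Y\<close> be a median space with base point \<open>x0\<close>. A wall \<open>{h, Y - h}\<close> with
  both sides convex is represented by its side \<open>h\<close> that avoids \<open>x0\<close>; let \<open>e x\<close> be the set of such
  half-spaces containing \<open>x\<close>. Distinct points are separated by a convex wall
  (\<open>halfspace_separation\<close>), so \<open>x \<mapsto> e x\<close> is injective; it turns medians into majorities and
  intervals into set inclusions (\<open>e_med\<close>, \<open>I_iff_e\<close>). Hence the differences \<open>e x - e j\<close> with \<open>j\<close>
  between \<open>x0\<close> and \<open>x\<close> form a semiring of sets, on which \<open>\<nu> (e x - e j) = dist(j, x)\<close> is to define
  a premeasure. Cutting \<open>e x - e j\<close> along any \<open>e c\<close> splits \<open>dist(j, x)\<close> accordingly, because opposite
  sides of a rectangle in a median space have equal length (\<open>interval_split\<close>); this yields both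
  that \<open>\<nu>\<close> is well defined and that it is finitely additive.
  Countable additivity is then automatic: the half-spaces form a closed, hence compact, subset of
  the power set of \<open>Y\<close>, and the sets of the semiring are clopen in it, so a countable cover of one
  of them by others has a finite subcover. Caratheodory's theorem extends \<open>\<nu>\<close> to a measure, and
  the set of half-spaces separating \<open>a\<close> from \<open>b\<close> is the union of \<open>e a - e m\<close> and \<open>e b - e m\<close>, where
  \<open>m\<close> is the median of \<open>x0, a, b\<close>; its measure is \<open>dist(m, a) + dist(m, b) = dist(a, b)\<close>.
  Restricting half-spaces of \<open>Y\<close> to an isometrically embedded \<open>X\<close> pushes this measure forward to
  the convex walls of \<open>X\<close>.
\<close>

section \<open>Median metric spaces\<close>

locale median_metric =
  fixes Y :: "'b metric"
  assumes median: "median_space Y"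
begin

abbreviation "S \<equiv> mspace Y"
abbreviation "d \<equiv> mdist Y"
abbreviation "I \<equiv> metric_interval Y"

text \<open>
  The median of three points of \<open>Y\<close>; the value is meaningful only for arguments in \<open>Y\<close>.
\<close>

definition med :: "'b \<Rightarrow> 'b \<Rightarrow> 'b \<Rightarrow> 'b" where
  "med a b c = (THE m. I a b \<inter> I b c \<inter> I a c = {m})"

lemma in_I: "z \<in> I a b \<longleftrightarrow> z \<in> S \<and> d a z + d z b = d a b"
  by (auto simp: metric_interval_def)

lemma I_commute: "I a b = I b a"
  by (auto simp: in_I mdist_commute add.commute)

lemma I_subset: "I a b \<subseteq> S"
  by (auto simp: in_I)

lemma I_ends: "a \<in> S \<Longrightarrow> b \<in> S \<Longrightarrow> a \<in> I a b \<and> b \<in> I a b"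
  by (simp add: in_I)

lemma I_refl:
  assumes "a \<in> S"
  shows "I a a = {a}"
proof -
  have *: "d a a = 0" using assms by simp
  have "d a z + d z a = d a a \<longleftrightarrow> z = a" if "z \<in> S" for z
    using assms that mdist_commute[of Y a z] by (auto simp: *)
  then show ?thesis using assms by (auto simp: in_I)
qed

lemma med_Int:
  assumes "a \<in> S" "b \<in> S" "c \<in> S"
  shows "I a b \<inter> I b c \<inter> I a c = {med a b c}"
proof -
  obtain m where m: "I a b \<inter> I b c \<inter> I a c = {m}"
    using median assms unfolding median_space_def by blast
  then have "med a b c = m" unfolding med_def by auto
  with m show ?thesis by simp
qed

lemma med_in:
  assumes "a \<in> S" "b \<in> S" "c \<in> S"
  shows "med a b c \<in> S" "med a b c \<in> I a b" "med a b c \<in> I b c" "med a b c \<in> I a c"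
  using med_Int[OF assms] by (auto simp: in_I)

lemma med_eqI:
  assumes "a \<in> S" "b \<in> S" "c \<in> S" "p \<in> I a b" "p \<in> I b c" "p \<in> I a c"
  shows "p = med a b c"
  using med_Int[OF assms(1-3)] assms(4-6) by blast

lemma I_trans:
  assumes "r \<in> S" "c \<in> S" "m \<in> I r c" "j \<in> I r m"
  shows "j \<in> I r c" "m \<in> I j c"
proof -
  have "j \<in> S" "m \<in> S" using assms by (auto simp: in_I)
  then have "d r c \<le> d r j + d j c" "d j c \<le> d j m + d m c"
    using assms by (auto intro: mdist_triangle)
  with assms show "j \<in> I r c" "m \<in> I j c" by (auto simp: in_I)
qed

text \<open>
  If \<open>a, n, c, n', b\<close> lie in this order on a geodesic, then replacing \<open>c\<close> by any other point between
  \<open>n\<close> and \<open>n'\<close> again gives a geodesic from \<open>a\<close> to \<open>b\<close>.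
\<close>

lemma I_nested:
  assumes "a \<in> S" "b \<in> S" "c \<in> I a b" "n \<in> I a c" "n' \<in> I c b"
  shows "c \<in> I n n'" "I n n' \<subseteq> I a b"
proof -
  have S: "c \<in> S" "n \<in> S" "n' \<in> S" using assms by (auto simp: in_I)
  have t: "d n n' \<le> d n c + d c n'" "d a n' \<le> d a n + d n n'" "d a b \<le> d a n' + d n' b"
    using assms(1,2) S by (auto intro: mdist_triangle)
  have e: "d a c + d c b = d a b" "d a n + d n c = d a c" "d c n' + d n' b = d c b"
    using assms by (auto simp: in_I)
  show "c \<in> I n n'" using S t e by (auto simp: in_I)
  show "I n n' \<subseteq> I a b"
  proof
    fix p assume p: "p \<in> I n n'"
    then have pS: "p \<in> S" and pe: "d n p + d p n' = d n n'" by (auto simp: in_I)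
    have "d a p \<le> d a n + d n p" "d p b \<le> d p n' + d n' b" "d a b \<le> d a p + d p b"
      using assms(1,2) S pS by (auto intro: mdist_triangle)
    then show "p \<in> I a b" using t e pe pS by (auto simp: in_I)
  qed
qed

text \<open>
  The median of \<open>a, b, r\<close> is the gate of \<open>r\<close> in \<open>I a b\<close>: it lies between \<open>r\<close> and every point of
  \<open>I a b\<close>.
\<close>

lemma med_gate:
  assumes S: "a \<in> S" "b \<in> S" "r \<in> S" and c: "c \<in> I a b"
  shows "med a b r \<in> I r c"
proof -
  have cS: "c \<in> S" using c by (simp add: in_I)
  define n n' where "n = med a c r" and "n' = med c b r"
  note n = med_in[OF S(1) cS S(3), folded n_def] and n' = med_in[OF cS S(2,3), folded n'_def]
  define p where "p = med n n' r"
  note p = med_in[OF n(1) n'(1) S(3), folded p_def]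
  \<comment> \<open>\<open>p\<close> satisfies the conditions that define \<open>med a b r\<close>, and it also lies between \<open>r\<close> and \<open>c\<close>.\<close>
  have "p \<in> I r a" using I_trans(1)[of r a n p] S n p by (simp add: I_commute)
  moreover have "p \<in> I r b" using I_trans(1)[of r b n' p] S n' p by (simp add: I_commute)
  moreover have "p \<in> I a b" using I_nested(2)[OF S(1,2) c n(2) n'(2)] p(2) by blast
  ultimately have "p = med a b r" using med_eqI[of a b r p] S by (simp add: I_commute)
  moreover have "p \<in> I r c" using I_trans(1)[of r c n p] S cS n p by (simp add: I_commute)
  ultimately show ?thesis by simp
qed

lemma I_geodesic_return:
  assumes "p \<in> S" "q \<in> S" "z \<in> I p q" "m \<in> I z p" "m \<in> I z q"
  shows "z = m"
proof -
  have S: "z \<in> S" "m \<in> S" using assms by (auto simp: in_I)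
  have "d p q \<le> d p m + d m q" using assms S by (auto intro: mdist_triangle)
  moreover have "d z m + d m p = d z p" "d z m + d m q = d z q" "d p z + d z q = d p q"
    using assms by (auto simp: in_I)
  moreover have "d p z = d z p" "d p m = d m p" by (simp_all add: mdist_commute)
  ultimately have "d z m \<le> 0" by linarith
  then show ?thesis using S mdist_nonneg[of Y z m] by simp
qed

text \<open>
  Geodesics from \<open>z\<close> to \<open>a\<close> and from \<open>z\<close> to \<open>p\<close> share only points between \<open>z\<close> and the median of
  \<open>a, p, z\<close>.
\<close>

lemma I_Int_med:
  assumes S: "z \<in> S" "a \<in> S" "p \<in> S" and w: "w \<in> I z a" "w \<in> I z p"
  shows "w \<in> I z (med a p z)"
proof -
  have wS: "w \<in> S" using w by (simp add: in_I)
  define g where "g = med a p w"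
  note g = med_in[OF S(2,3) wS, folded g_def]
  have *: "g \<in> I z t \<and> w \<in> I z g" if "t \<in> S" "w \<in> I z t" "g \<in> I w t" for t
    using I_trans[of t z w g] that S by (simp add: I_commute)
  have "g \<in> I z a" "g \<in> I z p" "w \<in> I z g"
    using * S w g by (auto simp: I_commute)
  then have "g = med a p z" using med_eqI[of a p z g] S g by (simp add: I_commute)
  with \<open>w \<in> I z g\<close> show ?thesis by simp
qed

definition conv :: "'b set \<Rightarrow> bool" where "conv = metric_convex Y"

lemma convD: "conv h \<Longrightarrow> a \<in> h \<Longrightarrow> b \<in> h \<Longrightarrow> z \<in> I a b \<Longrightarrow> z \<in> h"
  unfolding conv_def metric_convex_def by blast

lemma conv_subset: "conv h \<Longrightarrow> h \<subseteq> S"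
  unfolding conv_def metric_convex_def by blast

text \<open>
  The convex hull of \<open>h \<union> {a}\<close>, for nonempty convex \<open>h\<close>, is the union of the intervals joining
  \<open>a\<close> to the points of \<open>h\<close>.
\<close>

lemma conv_join:
  assumes h: "conv h" and a: "a \<in> S"
  shows "conv (\<Union>p\<in>h. I p a)"
  unfolding conv_def metric_convex_def
proof (intro conjI ballI subsetI)
  show "z \<in> S" if "z \<in> (\<Union>p\<in>h. I p a)" for z using that by (auto simp: in_I)
next
  fix u v z assume "u \<in> (\<Union>p\<in>h. I p a)" "v \<in> (\<Union>p\<in>h. I p a)" and z: "z \<in> I u v"
  then obtain p q where p: "p \<in> h" "u \<in> I p a" and q: "q \<in> h" "v \<in> I q a" by blast
  have S: "p \<in> S" "q \<in> S" "u \<in> S" "v \<in> S" "z \<in> S"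
    using p q z conv_subset[OF h] by (auto simp: in_I)
  define r where "r = med p q z"
  note r = med_in[OF S(1,2,5), folded r_def]
  have rh: "r \<in> h" using convD[OF h p(1) q(1)] r(2) .
  define w where "w = med r a z"
  note w = med_in[OF r(1) a S(5), folded w_def]
  define s s' where "s = med a p z" and "s' = med a q z"
  note s = med_in[OF a S(1,5), folded s_def] and s' = med_in[OF a S(2,5), folded s'_def]
  \<comment> \<open>The candidate \<open>r\<close> works if \<open>w = z\<close>. The point \<open>w\<close> lies on geodesics from \<open>z\<close> to both \<open>s\<close> and
    \<open>s'\<close>, while \<open>z\<close> itself lies between \<open>s\<close> and \<open>s'\<close>.\<close>
  have "w \<in> I z p" "w \<in> I z q"
    using I_trans(1)[of z p r w] I_trans(1)[of z q r w] S w r by (auto simp: I_commute)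
  then have ws: "w \<in> I z s" "w \<in> I z s'"
    unfolding s_def s'_def using I_Int_med a S w by (auto simp: I_commute)
  have "s \<in> I z u" "s' \<in> I z v"
    unfolding s_def s'_def using med_gate[of a p z u] med_gate[of a q z v] a S p q
    by (simp_all add: I_commute)
  then have "z \<in> I s s'" using I_nested(1)[of u v z s s'] S z by (simp add: I_commute)
  then have "z = w" using I_geodesic_return[OF s(1) s'(1)] ws by blast
  then show "z \<in> (\<Union>p\<in>h. I p a)" using rh w(2) by blast
qed

text \<open>
  A convex set that is maximal among those containing \<open>x\<close> but not \<open>j\<close> has a convex complement.
\<close>

lemma halfspace_separation:
  assumes x: "x \<in> S" and j: "j \<in> S" and "x \<noteq> j"
  obtains h where "conv h" "conv (S - h)" "x \<in> h" "j \<notin> h"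
proof -
  define \<A> where "\<A> = {h. conv h \<and> x \<in> h \<and> j \<notin> h}"
  have "\<exists>M\<in>\<A>. \<forall>h\<in>\<A>. M \<subseteq> h \<longrightarrow> h = M"
  proof (rule subset_Zorn_nonempty)
    show "\<A> \<noteq> {}"
      using x \<open>x \<noteq> j\<close> I_refl[OF x] by (auto simp: \<A>_def conv_def metric_convex_def)
  next
    fix \<C> assume "\<C> \<noteq> {}" and ch: "subset.chain \<A> \<C>"
    have "\<C> \<subseteq> \<A>" using ch by (simp add: subset.chain_def)
    moreover have "I a b \<subseteq> \<Union>\<C>" if ab: "a \<in> \<Union>\<C>" "b \<in> \<Union>\<C>" for a b
    proof -
      obtain A B where AB: "A \<in> \<C>" "a \<in> A" "B \<in> \<C>" "b \<in> B" using ab by blast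
      then have "A \<subseteq> B \<or> B \<subseteq> A" using ch by (auto simp: subset_chain_def)
      then obtain C where "C \<in> \<C>" "a \<in> C" "b \<in> C" using AB by blast
      then show ?thesis using \<open>\<C> \<subseteq> \<A>\<close> convD[of C a b] unfolding \<A>_def by blast
    qed
    ultimately show "\<Union>\<C> \<in> \<A>"
      using \<open>\<C> \<noteq> {}\<close> conv_subset by (fastforce simp: \<A>_def conv_def metric_convex_def)
  qed
  then obtain h where h: "conv h" "x \<in> h" "j \<notin> h"
    and max: "\<And>k. conv k \<Longrightarrow> j \<notin> k \<Longrightarrow> h \<subseteq> k \<Longrightarrow> k = h"
    unfolding \<A>_def by blast
  \<comment> \<open>By maximality \<open>j\<close> lies in the convex hull of \<open>h\<close> and any further point.\<close>
  have ex: "\<exists>p\<in>h. j \<in> I p a" if a: "a \<in> S" "a \<notin> h" for a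
  proof (rule ccontr)
    assume "\<not> ?thesis"
    moreover have "p \<in> I p a" "a \<in> I p a" if "p \<in> h" for p
      using that a h conv_subset I_ends by blast+
    ultimately have "(\<Union>p\<in>h. I p a) = h"
      using max conv_join[OF h(1) a(1)] by blast
    then show False using \<open>a \<notin> h\<close> \<open>x \<in> h\<close> \<open>\<And>p. p \<in> h \<Longrightarrow> a \<in> I p a\<close> by blast
  qed
  have "conv (S - h)"
    unfolding conv_def metric_convex_def
  proof (intro conjI ballI subsetI)
    fix a b c assume ab: "a \<in> S - h" "b \<in> S - h" and c: "c \<in> I a b"
    obtain p q where p: "p \<in> h" "j \<in> I p a" and q: "q \<in> h" "j \<in> I q b" using ex ab by blast
    have S: "a \<in> S" "b \<in> S" "c \<in> S" "p \<in> S" "q \<in> S"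
      using ab c p q conv_subset[OF h(1)] by (auto simp: in_I)
    \<comment> \<open>A single point \<open>r\<close> of \<open>h\<close> serves both \<open>a\<close> and \<open>b\<close>; if \<open>c\<close> were in \<open>h\<close>, then so would be \<open>j\<close>,
      which lies between \<open>r\<close> and \<open>c\<close>.\<close>
    define r where "r = med p q j"
    note r = med_in[OF S(4,5) j, folded r_def]
    have "r \<in> h" using convD[OF h(1) p(1) q(1) r(2)] .
    have "j \<in> I r a" "j \<in> I r b"
      using I_trans(2)[of p a j r] I_trans(2)[of q b j r] S p q r by auto
    then have "j \<in> I r (med a b r)" using I_Int_med S r by blast
    moreover have "med a b r \<in> I r c" using med_gate S r c by blast
    ultimately have "j \<in> I r c" using I_trans(1) r S by blast
    then show "c \<in> S - h" using convD[OF h(1) \<open>r \<in> h\<close>] h(3) S by blast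
  qed auto
  with h that show thesis by blast
qed

end

section \<open>The measure on the half-spaces avoiding a base point\<close>

locale pointed_median_metric = median_metric Y for Y :: "'b metric" +
  fixes x0 :: 'b
  assumes x0: "x0 \<in> S"
begin

text \<open>
  The convex walls of \<open>Y\<close>, each represented by its side that avoids \<open>x0\<close>. The trivial wall, with
  empty side, is included; this makes the set compact.
\<close>

definition halfspaces :: "'b set set" where
  "halfspaces = {h. conv h \<and> conv (S - h) \<and> x0 \<notin> h}"

text \<open>
  The half-spaces separating \<open>x\<close> from the base point.
\<close>

definition e :: "'b \<Rightarrow> 'b set set" where
  "e x = {h \<in> halfspaces. x \<in> h}"

lemma halfspace_med:
  assumes "h \<in> halfspaces" "a \<in> S" "b \<in> S" "c \<in> S"
  shows "med a b c \<in> h \<longleftrightarrow> (a \<in> h \<and> b \<in> h) \<or> (b \<in> h \<and> c \<in> h) \<or> (a \<in> h \<and> c \<in> h)"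
proof -
  note m = med_in[OF assms(2-4)]
  have maj: "med a b c \<in> k"
    if "conv k" "(a \<in> k \<and> b \<in> k) \<or> (b \<in> k \<and> c \<in> k) \<or> (a \<in> k \<and> c \<in> k)" for k
    using that(2) convD[OF that(1) _ _ m(2)] convD[OF that(1) _ _ m(3)] convD[OF that(1) _ _ m(4)]
    by blast
  show ?thesis
    using maj[of h] maj[of "S - h"] assms by (auto simp: halfspaces_def)
qed

lemma e_med:
  "a \<in> S \<Longrightarrow> b \<in> S \<Longrightarrow> c \<in> S \<Longrightarrow> e (med a b c) = (e a \<inter> e b) \<union> (e b \<inter> e c) \<union> (e a \<inter> e c)"
  by (auto simp: e_def halfspace_med)

lemma e_x0: "e x0 = {}"
  by (auto simp: e_def halfspaces_def)

lemma e_inj: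
  assumes "a \<in> S" "b \<in> S" "e a = e b"
  shows "a = b"
proof (rule ccontr)
  assume "a \<noteq> b"
  then obtain h where h: "conv h" "conv (S - h)" "a \<in> h" "b \<notin> h"
    using halfspace_separation assms by blast
  have "S - (S - h) = h" using conv_subset[OF h(1)] by blast
  \<comment> \<open>Either \<open>h\<close> or its complement avoids \<open>x0\<close>.\<close>
  then have "h \<in> halfspaces \<or> S - h \<in> halfspaces"
    using h x0 by (auto simp: halfspaces_def)
  then have "(h \<in> e a \<and> h \<notin> e b) \<or> (S - h \<in> e b \<and> S - h \<notin> e a)"
    using h assms(1,2) by (auto simp: e_def)
  then show False using assms(3) by simp
qed

lemma I_iff_e:
  assumes "a \<in> S" "b \<in> S" "c \<in> S"
  shows "c \<in> I a b \<longleftrightarrow> e a \<inter> e b \<subseteq> e c \<and> e c \<subseteq> e a \<union> e b"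
proof
  assume "c \<in> I a b"
  then have "c = med a b c" using med_eqI[of a b c c] I_ends assms by blast
  then have "e c = (e a \<inter> e b) \<union> (e b \<inter> e c) \<union> (e a \<inter> e c)" using e_med[OF assms] by simp
  then show "e a \<inter> e b \<subseteq> e c \<and> e c \<subseteq> e a \<union> e b" by blast
next
  assume "e a \<inter> e b \<subseteq> e c \<and> e c \<subseteq> e a \<union> e b"
  then have "e (med a b c) = e c" using e_med[OF assms] by blast
  then have "med a b c = c" using e_inj[OF med_in(1)[OF assms] assms(3)] by simp
  then show "c \<in> I a b" using med_in(2)[OF assms] by simp
qed

lemma below_iff: "x \<in> S \<Longrightarrow> j \<in> I x0 x \<longleftrightarrow> j \<in> S \<and> e j \<subseteq> e x"
  using I_iff_e[OF x0, of x j] I_subset e_x0 by auto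

text \<open>
  Opposite sides of the rectangle with corners \<open>k, j, b, y\<close> have equal length.
\<close>

lemma rectangle:
  assumes "k \<in> I j y" "b \<in> I j y" "j \<in> I k b" "y \<in> I k b"
  shows "d j b = d k y"
  using assms mdist_commute[of Y k j] mdist_commute[of Y b y] by (auto simp: in_I)

text \<open>
  Cutting \<open>e x - e j\<close> along \<open>e c\<close> produces two sets \<open>e y - e k\<close> and \<open>e x - e b\<close> of the same form,
  and the distances add up. Here \<open>y\<close> and \<open>k\<close> are the meets of \<open>x\<close> and \<open>j\<close> with \<open>c\<close>, and \<open>b\<close> is the
  join of \<open>j\<close> and \<open>y\<close>, with respect to the order by betweenness from \<open>x0\<close>.
\<close>

lemma interval_split:
  assumes x: "x \<in> S" and j: "j \<in> I x0 x" and c: "c \<in> S"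
  obtains y k b where "y \<in> S" "k \<in> I x0 y" "b \<in> I x0 x"
    "e y = e x \<inter> e c" "e k = e j \<inter> e c" "e b = e j \<union> (e x \<inter> e c)"
    "d j x = d k y + d b x"
proof -
  have jS: "j \<in> S" and jx: "e j \<subseteq> e x" using below_iff x j by auto
  define y k where "y = med x0 x c" and "k = med x0 j c"
  have y: "y \<in> S" "e y = e x \<inter> e c" using x c x0 by (auto simp: y_def med_in e_med e_x0)
  have k: "k \<in> S" "e k = e j \<inter> e c" using jS c x0 by (auto simp: k_def med_in e_med e_x0)
  define b where "b = med x j y"
  have b: "b \<in> S" "e b = e j \<union> (e x \<inter> e c)"
    using x jS y jx by (auto simp: b_def med_in e_med)
  have "d j b = d k y"
    by (rule rectangle) (use I_iff_e jS y k b jx in auto)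
  moreover have "b \<in> I j x" using I_iff_e jS x b jx by auto
  then have "d j x = d j b + d b x" by (simp add: in_I)
  ultimately have "d j x = d k y + d b x" by simp
  moreover have "k \<in> I x0 y" "b \<in> I x0 x" using below_iff x y k b jx by auto
  ultimately show thesis using that y k b by blast
qed

text \<open>
  The half-spaces that separate \<open>x\<close> from \<open>j\<close>, for \<open>j\<close> between \<open>x0\<close> and \<open>x\<close>. These sets form the
  semiring on which the measure is first defined.
\<close>

definition cells :: "'b set set set" where
  "cells = {e x - e j | x j. x \<in> S \<and> j \<in> I x0 x}"

text \<open>
  The premeasure of the cell \<open>e x - e j\<close> is \<open>d j x\<close>. By \<open>cell_dist_unique\<close> below it depends only
  on the cell.
\<close>

definition \<nu> :: "'b set set \<Rightarrow> real" where
  "\<nu> P = (THE r. \<exists>x\<in>S. \<exists>j\<in>I x0 x. P = e x - e j \<and> r = d j x)"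

lemma cellE:
  assumes "P \<in> cells"
  obtains x j where "x \<in> S" "j \<in> I x0 x" "P = e x - e j" "j \<in> S" "e j \<subseteq> e x"
proof -
  obtain x j where "x \<in> S" "j \<in> I x0 x" "P = e x - e j"
    using assms by (auto simp: cells_def)
  then show thesis using that below_iff[of x j] by simp
qed

lemma empty_cell: "x \<in> S \<Longrightarrow> j \<in> I x0 x \<Longrightarrow> e x \<subseteq> e j \<Longrightarrow> d j x = 0"
  using e_inj[of j x] below_iff by auto

text \<open>
  Both distances equal the distance between the points \<open>X\<close> and \<open>J\<close> determined by
  \<open>e X = e x \<inter> e y\<close> and \<open>e J = (e j \<inter> e y) \<union> (e k \<inter> e x)\<close>, an expression symmetric in the two
  representations of the cell.
\<close>

lemma cell_dist_unique:
  assumes x: "x \<in> S" "j \<in> I x0 x" and y: "y \<in> S" "k \<in> I x0 y" and eq: "e x - e j = e y - e k"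
  shows "d j x = d k y"
proof -
  have *: "\<exists>X J. X \<in> S \<and> J \<in> S \<and> e X = e x \<inter> e y \<and> e J = (e j \<inter> e y) \<union> (e k \<inter> e x)
      \<and> d j x = d J X"
    if x: "x \<in> S" "j \<in> I x0 x" and y: "y \<in> S" "k \<in> I x0 y" and eq: "e x - e j = e y - e k"
    for x j y k
  proof -
    have k: "k \<in> S" "e k \<subseteq> e y" using below_iff y by auto
    have j: "e j \<subseteq> e x" using below_iff x by auto
    obtain x' j' b where 1: "x' \<in> S" "j' \<in> I x0 x'" "b \<in> I x0 x"
      "e x' = e x \<inter> e y" "e j' = e j \<inter> e y" "e b = e j \<union> (e x \<inter> e y)"
      "d j x = d j' x' + d b x" using interval_split[OF x y(1)] by metis
    obtain x'' j'' b' where 2: "x'' \<in> S" "j'' \<in> I x0 x''" "b' \<in> I x0 x'"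
      "e x'' = e x' \<inter> e k" "e j'' = e j' \<inter> e k" "e b' = e j' \<union> (e x' \<inter> e k)"
      "d j' x' = d j'' x'' + d b' x'" using interval_split[OF 1(1,2) k(1)] by metis
    \<comment> \<open>The parts cut off along \<open>e y\<close> and then along \<open>e k\<close> are empty.\<close>
    have "d b x = 0" using empty_cell[OF x(1) 1(3)] 1 eq by blast
    moreover have "d j'' x'' = 0" using empty_cell[OF 2(1,2)] 1 2 eq by blast
    ultimately have "d j x = d b' x'" using 1 2 by simp
    moreover have "b' \<in> S" "e b' = (e j \<inter> e y) \<union> (e k \<inter> e x)"
      using 1 2 k below_iff by auto
    ultimately show ?thesis using 1 by blast
  qed
  obtain X J where 1: "X \<in> S" "J \<in> S" "e X = e x \<inter> e y" "e J = (e j \<inter> e y) \<union> (e k \<inter> e x)"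
    "d j x = d J X" using *[OF x y eq] by blast
  obtain X' J' where 2: "X' \<in> S" "J' \<in> S" "e X' = e y \<inter> e x" "e J' = (e k \<inter> e x) \<union> (e j \<inter> e y)"
    "d k y = d J' X'" using *[OF y x eq[symmetric]] by blast
  have "X = X'" "J = J'" using 1 2 by (auto intro!: e_inj)
  then show ?thesis using 1 2 by simp
qed

lemma \<nu>_cell: "x \<in> S \<Longrightarrow> j \<in> I x0 x \<Longrightarrow> \<nu> (e x - e j) = d j x"
  unfolding \<nu>_def using cell_dist_unique by (intro the_equality) blast+

lemma cell_split:
  assumes "P \<in> cells" "c \<in> S"
  shows "P \<inter> e c \<in> cells" "P - e c \<in> cells" "\<nu> P = \<nu> (P \<inter> e c) + \<nu> (P - e c)"
proof -
  obtain x j where x: "x \<in> S" "j \<in> I x0 x" and P: "P = e x - e j"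
    using cellE[OF assms(1)] by metis
  obtain y k b where s: "y \<in> S" "k \<in> I x0 y" "b \<in> I x0 x"
    "e y = e x \<inter> e c" "e k = e j \<inter> e c" "e b = e j \<union> (e x \<inter> e c)"
    "d j x = d k y + d b x" using interval_split[OF x assms(2)] by metis
  have eq: "P \<inter> e c = e y - e k" "P - e c = e x - e b" using P s by auto
  then show "P \<inter> e c \<in> cells" "P - e c \<in> cells" using x s by (auto simp: cells_def)
  show "\<nu> P = \<nu> (P \<inter> e c) + \<nu> (P - e c)"
    unfolding eq unfolding P \<nu>_cell[OF x] \<nu>_cell[OF s(1,2)] \<nu>_cell[OF x(1) s(3)] by (rule s(7))
qed

lemma empty_in_cells: "{} \<in> cells" and \<nu>_empty: "\<nu> {} = 0"
proof -
  have "x0 \<in> I x0 x0" using I_ends x0 by blast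
  then show "{} \<in> cells" "\<nu> {} = 0"
    using x0 \<nu>_cell[of x0 x0] by (auto simp: cells_def)
qed

lemma \<nu>_nonneg: "P \<in> cells \<Longrightarrow> 0 \<le> \<nu> P"
  by (erule cellE) (simp add: \<nu>_cell)

lemma cells_subset: "P \<in> cells \<Longrightarrow> P \<subseteq> halfspaces"
  by (auto simp: cells_def e_def)

lemma semiring_cells: "semiring_of_sets halfspaces cells"
proof
  show "cells \<subseteq> Pow halfspaces" using cells_subset by blast
  show "{} \<in> cells" by (rule empty_in_cells)
  fix P Q assume P: "P \<in> cells" and "Q \<in> cells"
  then obtain y k where y: "y \<in> S" "k \<in> S" "Q = e y - e k" "e k \<subseteq> e y" by (metis cellE)
  have "P \<inter> Q = (P \<inter> e y) - e k" using y by blast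
  then show "P \<inter> Q \<in> cells" using cell_split P y by simp
  have "P - Q = \<Union>{P - e y, P \<inter> e k}" "disjoint {P - e y, P \<inter> e k}"
    using y by (auto simp: disjoint_def)
  moreover have "{P - e y, P \<inter> e k} \<subseteq> cells" using cell_split P y by auto
  ultimately show "\<exists>C\<subseteq>cells. finite C \<and> disjoint C \<and> P - Q = \<Union>C"
    by (metis finite.emptyI finite_insert)
qed

lemma \<nu>_finite_additive:
  assumes "finite N"
  shows "P \<in> cells \<Longrightarrow> (\<And>i. i \<in> N \<Longrightarrow> A i \<in> cells) \<Longrightarrow> disjoint_family_on A N
    \<Longrightarrow> P = (\<Union>i\<in>N. A i) \<Longrightarrow> \<nu> P = (\<Sum>i\<in>N. \<nu> (A i))"
  using assms
proof (induction N arbitrary: P A rule: finite_induct)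
  case empty
  then show ?case by (simp add: \<nu>_empty)
next
  case (insert n N)
  obtain x j where xj: "x \<in> S" "j \<in> S" "A n = e x - e j" "e j \<subseteq> e x"
    using insert.prems(2)[of n] by (auto elim: cellE)
  have disjN: "A i \<inter> A k = {}" if "i \<in> insert n N" "k \<in> insert n N" "i \<noteq> k" for i k
    using insert.prems(3) that unfolding disjoint_family_on_def by blast
  have disj: "A i \<inter> A n = {}" if "i \<in> N" for i
    using disjN[of i n] insert.hyps that by blast
  \<comment> \<open>Cutting along \<open>e x\<close> and \<open>e j\<close> isolates the piece \<open>A n\<close>.\<close>
  have three: "\<nu> Q = \<nu> (Q - e x) + \<nu> (Q \<inter> A n) + \<nu> (Q \<inter> e j)" if Q: "Q \<in> cells" for Q
  proof -
    have "Q \<inter> e x \<inter> e j = Q \<inter> e j" "Q \<inter> e x - e j = Q \<inter> A n" using xj by auto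
    then show ?thesis
      using cell_split(3)[OF Q xj(1)] cell_split(3)[OF cell_split(1)[OF Q xj(1)] xj(2)] by simp
  qed
  have "\<nu> P = \<nu> (P - e x) + \<nu> (A n) + \<nu> (P \<inter> e j)"
    using three[OF insert.prems(1)] insert.prems(4) by (simp add: Int_absorb1)
  also have "\<nu> (P - e x) = (\<Sum>i\<in>N. \<nu> (A i - e x))"
  proof (rule insert.IH)
    show "disjoint_family_on (\<lambda>i. A i - e x) N"
      using disjN unfolding disjoint_family_on_def by blast
  qed (use insert.prems cell_split xj in auto)
  also have "\<nu> (P \<inter> e j) = (\<Sum>i\<in>N. \<nu> (A i \<inter> e j))"
  proof (rule insert.IH)
    show "disjoint_family_on (\<lambda>i. A i \<inter> e j) N"
      using disjN unfolding disjoint_family_on_def by blast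
  qed (use insert.prems cell_split xj in auto)
  finally have "\<nu> P = \<nu> (A n) + (\<Sum>i\<in>N. \<nu> (A i - e x) + \<nu> (A i \<inter> e j))"
    by (simp add: sum.distrib)
  also have "(\<Sum>i\<in>N. \<nu> (A i - e x) + \<nu> (A i \<inter> e j)) = (\<Sum>i\<in>N. \<nu> (A i))"
    using three insert.prems(2) disj by (intro sum.cong) (auto simp: \<nu>_empty)
  finally show ?case using insert.hyps by simp
qed

lemma clopen_coordinate:
  "open {g :: 'b \<Rightarrow> bool. g y}" "closed {g :: 'b \<Rightarrow> bool. g y}"
proof -
  have c: "continuous_on UNIV (\<lambda>g :: 'b \<Rightarrow> bool. g y)"
    by (rule continuous_on_product_coordinates)
  have o: "open ((\<lambda>g :: 'b \<Rightarrow> bool. g y) -` B)" for B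
    by (rule open_vimage[OF open_discrete c])
  have "{g :: 'b \<Rightarrow> bool. g y} = (\<lambda>g. g y) -` {True}"
    "- {g :: 'b \<Rightarrow> bool. g y} = (\<lambda>g. g y) -` {False}" by auto
  then show "open {g :: 'b \<Rightarrow> bool. g y}" "closed {g :: 'b \<Rightarrow> bool. g y}"
    unfolding closed_def using o by simp_all
qed

text \<open>
  Subsets of \<open>Y\<close> are handled as predicates, since the function type carries the product topology.
\<close>

lemma compact_UNIV_bool_fun: "compact (UNIV :: ('b \<Rightarrow> bool) set)"
proof -
  have "compact_space (product_topology (\<lambda>_ :: 'b. euclidean :: bool topology) UNIV)"
    by (intro iffD2[OF compact_space_product_topology] disjI2 ballI)
       (simp add: compact_space_def finite_imp_compact)
  then show ?thesis
    by (simp add: euclidean_product_topology compact_space_def)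
qed

text \<open>
  Each condition involves at most three points, so it is a closed condition in the product topology.
\<close>

lemma halfspaces_iff:
  "h \<in> halfspaces \<longleftrightarrow> x0 \<notin> h \<and> h \<subseteq> S \<and>
    (\<forall>a\<in>S. \<forall>b\<in>S. \<forall>z\<in>I a b. (a \<in> h \<longrightarrow> b \<in> h \<longrightarrow> z \<in> h) \<and> (z \<in> h \<longrightarrow> a \<in> h \<or> b \<in> h))"
  (is "_ \<longleftrightarrow> _ \<and> _ \<and> ?Q")
proof -
  have conv_iff: "conv k \<longleftrightarrow> k \<subseteq> S \<and> (\<forall>a\<in>k. \<forall>b\<in>k. \<forall>z\<in>I a b. z \<in> k)" for k
    by (simp only: conv_def metric_convex_def subset_eq)
  have zS: "z \<in> S" if "z \<in> I a b" for a b z using that by (simp add: in_I)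
  have "conv h \<and> conv (S - h) \<longleftrightarrow> h \<subseteq> S \<and> ?Q"
  proof
    assume "conv h \<and> conv (S - h)"
    then have h: "conv h" "conv (S - h)" by auto
    have ?Q
    proof (intro ballI conjI impI)
      fix a b z assume a: "a \<in> S" "b \<in> S" "z \<in> I a b"
      show "z \<in> h" if "a \<in> h" "b \<in> h" using convD[OF h(1) that a(3)] .
      show "a \<in> h \<or> b \<in> h" if "z \<in> h" using convD[OF h(2) _ _ a(3)] a that by blast
    qed
    with conv_subset[OF h(1)] show "h \<subseteq> S \<and> ?Q" by blast
  next
    assume Q: "h \<subseteq> S \<and> ?Q"
    show "conv h \<and> conv (S - h)"
      unfolding conv_iff
    proof (intro conjI ballI)
      fix a b z
      note Q' = bspec[OF bspec[OF bspec[OF conjunct2[OF Q], of a], of b], of z]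
      show "z \<in> h" if "a \<in> h" "b \<in> h" "z \<in> I a b" using Q' Q that by auto
      show "z \<in> S - h" if "a \<in> S - h" "b \<in> S - h" "z \<in> I a b" using Q' that zS by auto
    qed (use Q in auto)
  qed
  then have "conv h \<and> conv (S - h) \<and> x0 \<notin> h \<longleftrightarrow> x0 \<notin> h \<and> h \<subseteq> S \<and> ?Q"
    by argo
  then show ?thesis by (simp only: halfspaces_def mem_Collect_eq)
qed

lemma closed_halfspaces: "closed {g. Collect g \<in> halfspaces}"
proof -
  have not: "closed {g :: 'b \<Rightarrow> bool. \<not> g y}" for y
    using clopen_coordinate(1)[of y] by (simp add: closed_def Collect_neg_eq)
  have "{g. Collect g \<in> halfspaces} =
      {g. \<not> g x0} \<inter> (\<Inter>y\<in>-S. {g. \<not> g y}) \<inter>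
      (\<Inter>a\<in>S. \<Inter>b\<in>S. \<Inter>z\<in>I a b. ({g. \<not> g a} \<union> {g. \<not> g b} \<union> {g. g z})
        \<inter> ({g. g a} \<union> {g. g b} \<union> {g. \<not> g z}))"
    by (simp only: halfspaces_iff set_eq_iff Int_iff Un_iff INT_iff mem_Collect_eq subset_eq
        Compl_iff) blast
  also have "closed \<dots>"
    by (intro closed_Int closed_INT ballI closed_Un not clopen_coordinate)
  finally show ?thesis .
qed

lemma cell_finite_subcover:
  fixes A :: "nat \<Rightarrow> 'b set set"
  assumes P: "P \<in> cells" and A: "\<And>i. A i \<in> cells" and cover: "P \<subseteq> (\<Union>i. A i)"
  obtains N where "finite N" "P \<subseteq> (\<Union>i\<in>N. A i)"
proof -
  obtain x j where xj: "P = e x - e j" by (rule cellE[OF P])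
  have "\<exists>y k. A i = e y - e k" for i by (rule cellE[OF A[of i]]) blast
  then obtain y k where yk: "\<And>i. A i = e (y i) - e (k i)" by metis
  define C where "C = {g. Collect g \<in> P}"
  define U where "U i = {g. g (y i)} - {g. g (k i)}" for i
  have "C = {g. Collect g \<in> halfspaces} \<inter> {g. g x} - {g. g j}"
    by (auto simp: C_def xj e_def)
  then have "closed C"
    using closed_halfspaces clopen_coordinate by (simp add: closed_Int closed_Diff)
  then have C: "compact C" using compact_Int_closed[OF compact_UNIV_bool_fun] by simp
  have U: "open (U i)" for i
    unfolding U_def using clopen_coordinate by (simp add: open_Diff)
  have "C \<subseteq> (\<Union>i\<in>UNIV. U i)"
  proof
    fix g assume "g \<in> C"
    then have "Collect g \<in> P" by (simp add: C_def)
    then obtain i where "Collect g \<in> A i" using cover by blast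
    then have "g \<in> U i" by (simp add: yk e_def U_def)
    then show "g \<in> (\<Union>i\<in>UNIV. U i)" by blast
  qed
  then obtain N where N: "finite N" "C \<subseteq> (\<Union>i\<in>N. U i)"
    by (rule compactE_image[OF C U])
  have "P \<subseteq> (\<Union>i\<in>N. A i)"
  proof
    fix h assume h: "h \<in> P"
    then have "(\<lambda>z. z \<in> h) \<in> C" by (simp add: C_def)
    then obtain i where "i \<in> N" "(\<lambda>z. z \<in> h) \<in> U i" using N(2) by blast
    then have "i \<in> N" "h \<in> A i" using h by (simp_all add: xj yk e_def U_def)
    then show "h \<in> (\<Union>i\<in>N. A i)" by blast
  qed
  with N(1) that show thesis by blast
qed

lemma \<nu>_countably_additive: "countably_additive cells (\<lambda>P. ennreal (\<nu> P))"
  unfolding countably_additive_def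
proof (intro allI impI)
  fix A :: "nat \<Rightarrow> 'b set set"
  assume "range A \<subseteq> cells" and disj: "disjoint_family A" and P: "(\<Union>i. A i) \<in> cells"
  then have A: "A i \<in> cells" for i by (meson rangeI subsetD)
  obtain N where N: "finite N" "(\<Union>i. A i) \<subseteq> (\<Union>i\<in>N. A i)"
    by (rule cell_finite_subcover[OF P A order_refl])
  have empty: "A i = {}" if "i \<notin> N" for i
  proof -
    have "A i \<inter> A k = {}" if "k \<in> N" for k
      using disjoint_family_onD[OF disj, of i k] that \<open>i \<notin> N\<close> by auto
    moreover have "A i \<subseteq> (\<Union>k\<in>N. A k)" by (rule order_trans[OF _ N(2)]) auto
    ultimately show ?thesis by blast
  qed
  have "(\<Sum>i. ennreal (\<nu> (A i))) = (\<Sum>i\<in>N. ennreal (\<nu> (A i)))"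
    by (rule suminf_finite[OF N(1)]) (simp add: empty \<nu>_empty)
  also have "\<dots> = ennreal (\<Sum>i\<in>N. \<nu> (A i))"
    by (intro sum_ennreal \<nu>_nonneg A)
  also have "(\<Sum>i\<in>N. \<nu> (A i)) = \<nu> (\<Union>i. A i)"
  proof (rule \<nu>_finite_additive[symmetric, OF N(1) P A])
    show "disjoint_family_on A N" by (rule disjoint_family_on_mono[OF subset_UNIV disj])
    show "(\<Union>i. A i) = (\<Union>i\<in>N. A i)" by (rule equalityI[OF N(2)]) auto
  qed
  finally show "(\<Sum>i. ennreal (\<nu> (A i))) = ennreal (\<nu> (\<Union>i. A i))" .
qed

lemma halfspace_measure_exists:
  "\<exists>N. space N = halfspaces \<and>
    (\<forall>a\<in>S. \<forall>b\<in>S. {h \<in> halfspaces. (a \<in> h) \<noteq> (b \<in> h)} \<in> sets N \<and>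
      emeasure N {h \<in> halfspaces. (a \<in> h) \<noteq> (b \<in> h)} = ennreal (d a b))"
proof -
  interpret semiring_of_sets halfspaces cells by (rule semiring_cells)
  have "positive cells (\<lambda>P. ennreal (\<nu> P))" by (simp add: positive_def \<nu>_empty)
  from caratheodory[OF this \<nu>_countably_additive] obtain \<mu>
    where \<mu>: "\<And>P. P \<in> cells \<Longrightarrow> \<mu> P = ennreal (\<nu> P)"
      and ms: "measure_space halfspaces (sigma_sets halfspaces cells) \<mu>" by blast
  define N where "N = measure_of halfspaces cells \<mu>"
  have sets: "sets N = sigma_sets halfspaces cells" and space: "space N = halfspaces"
    using space_closed by (simp_all add: N_def)
  have em: "emeasure N P = ennreal (\<nu> P)" if "P \<in> cells" for P
  proof -
    have "emeasure N P = \<mu> P"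
      by (rule emeasure_measure_of[OF N_def])
         (use ms that space_closed sets in \<open>auto simp: measure_space_def\<close>)
    then show ?thesis using \<mu> that by simp
  qed
  have *: "{h \<in> halfspaces. (a \<in> h) \<noteq> (b \<in> h)} \<in> sets N \<and>
      emeasure N {h \<in> halfspaces. (a \<in> h) \<noteq> (b \<in> h)} = ennreal (d a b)"
    if ab: "a \<in> S" "b \<in> S" for a b
  proof -
    define m where "m = med x0 a b"
    note m = med_in[OF x0 ab, folded m_def]
    have em_eq: "e m = e a \<inter> e b" using e_med[OF x0 ab] e_x0 by (simp add: m_def)
    have c: "e a - e m \<in> cells" "e b - e m \<in> cells"
      unfolding cells_def using ab m by blast+
    have cs: "e a - e m \<in> sets N" "e b - e m \<in> sets N"
      unfolding sets using c by (simp_all add: sigma_sets.Basic)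
    have eq: "{h \<in> halfspaces. (a \<in> h) \<noteq> (b \<in> h)} = (e a - e m) \<union> (e b - e m)"
      unfolding em_eq by (auto simp: e_def)
    have "emeasure N ((e a - e m) \<union> (e b - e m)) = emeasure N (e a - e m) + emeasure N (e b - e m)"
      by (rule plus_emeasure[symmetric, OF cs]) (simp add: em_eq, blast)
    also have "\<dots> = ennreal (d m a) + ennreal (d m b)"
      unfolding em[OF c(1)] em[OF c(2)] \<nu>_cell[OF ab(1) m(2)] \<nu>_cell[OF ab(2) m(4)] ..
    also have "\<dots> = ennreal (d m a + d m b)" by (simp add: ennreal_plus)
    also have "d m a + d m b = d a b" using m(3) by (simp add: in_I mdist_commute[of Y m a])
    finally show ?thesis unfolding eq using cs by (simp add: sets.Un)
  qed
  show ?thesis by (intro exI[of _ N] conjI ballI space) (simp_all only: *)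
qed

end

section \<open>The median space of sets of finite measure\<close>

text \<open>
  The error term vanishes exactly when, up to a null set, \<open>C\<close> contains \<open>A \<inter> B\<close> and is contained in
  \<open>A \<union> B\<close>; this describes the intervals in the space of sets of finite measure.
\<close>

lemma measure_sym_diff_add:
  assumes "A \<in> fmeasurable M" "B \<in> fmeasurable M" "C \<in> fmeasurable M"
  shows "measure M (sym_diff A C) + measure M (sym_diff C B) =
    measure M (sym_diff A B) + 2 * measure M ((A \<inter> B - C) \<union> (C - (A \<union> B)))"
proof -
  have ind: "has_bochner_integral M (indicator T) (measure M T)" if "T \<in> fmeasurable M" for T
    using that has_bochner_integral_real_indicator[of T M] by (simp add: fmeasurable_def)
  define E where "E = (A \<inter> B - C) \<union> (C - (A \<union> B))"
  have f: "sym_diff A C \<in> fmeasurable M" "sym_diff C B \<in> fmeasurable M" "sym_diff A B \<in> fmeasurable M"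
    "E \<in> fmeasurable M"
    unfolding E_def using assms by (auto intro!: fmeasurable.Un fmeasurable.Diff fmeasurable.Int)
  have "(\<lambda>x. indicator (sym_diff A C) x + indicator (sym_diff C B) x :: real) =
      (\<lambda>x. indicator (sym_diff A B) x + 2 * indicator E x)"
    by (auto simp: E_def indicator_def)
  with has_bochner_integral_add[OF ind[OF f(1)] ind[OF f(2)]]
  have "has_bochner_integral M (\<lambda>x. indicator (sym_diff A B) x + 2 * indicator E x)
      (measure M (sym_diff A C) + measure M (sym_diff C B))"
    by simp
  moreover have "has_bochner_integral M (\<lambda>x. indicator (sym_diff A B) x + 2 * indicator E x)
      (measure M (sym_diff A B) + 2 * measure M E)"
    using has_bochner_integral_add[OF ind[OF f(3)] has_bochner_integral_mult_right[OF ind[OF f(4)], of 2]]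
    by simp
  ultimately show ?thesis
    unfolding E_def by (rule has_bochner_integral_eq)
qed

text \<open>
  The quotient modulo null sets is realised on a set of representatives, \<open>q A\<close> being the one in the
  class of \<open>A\<close>.
\<close>

lemma finite_measure_sets_median:
  fixes M :: "'a measure"
  shows "\<exists>(Z :: 'a set metric) q. median_space Z \<and>
    (\<forall>A\<in>fmeasurable M. q A \<in> mspace Z) \<and>
    (\<forall>A\<in>fmeasurable M. \<forall>B\<in>fmeasurable M. mdist Z (q A) (q B) = measure M (sym_diff A B))"
proof -
  define D where "D A B = measure M (sym_diff A B)" for A B
  let ?F = "fmeasurable M"
  have Fs: "sym_diff A B \<in> ?F" if "A \<in> ?F" "B \<in> ?F" for A B
    using that by (intro fmeasurable.Un fmeasurable.Diff)
  have D_add: "D A C + D C B = D A B + 2 * measure M ((A \<inter> B - C) \<union> (C - (A \<union> B)))"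
    if "A \<in> ?F" "B \<in> ?F" "C \<in> ?F" for A B C
    unfolding D_def using measure_sym_diff_add that .
  have D_tri: "D A B \<le> D A C + D C B" if "A \<in> ?F" "B \<in> ?F" "C \<in> ?F" for A B C
    using D_add[OF that] by simp
  have D_comm: "D A B = D B A" for A B by (simp add: D_def Un_commute)
  have D_nonneg: "0 \<le> D A B" for A B by (simp add: D_def)
  have D_self: "D A A = 0" for A by (simp add: D_def)
  \<comment> \<open>\<open>q\<close> picks one representative in each class of sets modulo null sets.\<close>
  define q where "q A = (SOME B. B \<in> ?F \<and> D A B = 0)" for A
  have q: "q A \<in> ?F" "D A (q A) = 0" if "A \<in> ?F" for A
    using someI[of "\<lambda>B. B \<in> ?F \<and> D A B = 0" A] that D_self by (auto simp: q_def)
  have D_cong: "D A C = D B C" if "A \<in> ?F" "B \<in> ?F" "C \<in> ?F" "D A B = 0" for A B C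
    using D_tri[of A C B] D_tri[of B C A] that D_comm[of A B] by simp
  have q_eq: "q A = q B" if "A \<in> ?F" "B \<in> ?F" "D A B = 0" for A B
  proof -
    have "(\<lambda>C. C \<in> ?F \<and> D A C = 0) = (\<lambda>C. C \<in> ?F \<and> D B C = 0)"
      using D_cong[OF that(1,2) _ that(3)] by auto
    then show ?thesis by (simp add: q_def)
  qed
  have D_q: "D (q A) (q B) = D A B" if "A \<in> ?F" "B \<in> ?F" for A B
    using D_cong[of A "q A" "q B"] D_cong[of B "q B" A] q that D_comm by metis
  have MS: "Metric_space (q ` ?F) D"
  proof
    fix A B C
    show "0 \<le> D A B" by (rule D_nonneg)
    show "D A B = D B A" by (rule D_comm)
    show "D A B = 0 \<longleftrightarrow> A = B" if AB: "A \<in> q ` ?F" "B \<in> q ` ?F"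
    proof
      assume 0: "D A B = 0"
      obtain A' B' where "A' \<in> ?F" "A = q A'" "B' \<in> ?F" "B = q B'" using AB by blast
      then show "A = B" using 0 D_q q_eq by simp
    qed (simp add: D_self)
    show "D A C \<le> D A B + D B C" if "A \<in> q ` ?F" "B \<in> q ` ?F" "C \<in> q ` ?F"
      using that q(1) by (intro D_tri) auto
  qed
  define Z where "Z = metric (q ` ?F, D)"
  have Zs: "mspace Z = q ` ?F" and Zd: "mdist Z = D"
    using MS by (simp_all add: Z_def Metric_space.mspace_metric Metric_space.mdist_metric)
  define null where "null A B C \<longleftrightarrow> measure M ((A \<inter> B - C) \<union> (C - (A \<union> B))) = 0" for A B C
  have int: "q C \<in> metric_interval Z (q A) (q B) \<longleftrightarrow> null A B C"
    if "A \<in> ?F" "B \<in> ?F" "C \<in> ?F" for A B C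
    using that D_add[OF that] by (simp add: metric_interval_def Zs Zd D_q null_def)
  have "median_space Z"
    unfolding median_space_def
  proof (intro ballI)
    fix A' B' C' assume "A' \<in> mspace Z" "B' \<in> mspace Z" "C' \<in> mspace Z"
    then obtain A B C where F: "A \<in> ?F" "B \<in> ?F" "C \<in> ?F"
      and eq: "A' = q A" "B' = q B" "C' = q C" by (auto simp: Zs)
    define m where "m = (A \<inter> B) \<union> (B \<inter> C) \<union> (A \<inter> C)"
    have mF: "m \<in> ?F" unfolding m_def using F by (intro fmeasurable.Un fmeasurable.Int)
    let ?J = "metric_interval Z A' B' \<inter> metric_interval Z B' C' \<inter> metric_interval Z A' C'"
    have "(A \<inter> B - m) \<union> (m - (A \<union> B)) = {}" "(B \<inter> C - m) \<union> (m - (B \<union> C)) = {}"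
      "(A \<inter> C - m) \<union> (m - (A \<union> C)) = {}" unfolding m_def by blast+
    then have "null A B m" "null B C m" "null A C m" by (simp_all only: null_def measure_empty)
    then have "q m \<in> ?J"
      using int[OF F(1,2) mF] int[OF F(2,3) mF] int[OF F(1,3) mF] by (simp add: eq)
    moreover have "P = q m" if P: "P \<in> ?J" for P
    proof -
      have "P \<in> q ` ?F" using P by (simp add: metric_interval_def Zs)
      then obtain Q where Q: "Q \<in> ?F" "P = q Q" by blast
      have null: "null A B Q" "null B C Q" "null A C Q"
        using P unfolding eq Q(2) Int_iff int[OF F(1,2) Q(1)] int[OF F(2,3) Q(1)] int[OF F(1,3) Q(1)]
        by auto
      define E where "E A B = (A \<inter> B - Q) \<union> (Q - (A \<union> B))" for A B
      have E: "E A B \<in> ?F" "E B C \<in> ?F" "E A C \<in> ?F"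
        unfolding E_def using F Q by (auto intro!: fmeasurable.Un fmeasurable.Diff fmeasurable.Int)
      have "D Q m \<le> measure M (E A B \<union> E B C \<union> E A C)"
        unfolding D_def
      proof (rule measure_mono_fmeasurable)
        show "sym_diff Q m \<subseteq> E A B \<union> E B C \<union> E A C" unfolding E_def m_def by blast
        show "sym_diff Q m \<in> sets M" using Fs[OF Q(1) mF] by (rule fmeasurableD)
        show "E A B \<union> E B C \<union> E A C \<in> ?F" using E by (intro fmeasurable.Un)
      qed
      also have "\<dots> \<le> measure M (E A B) + measure M (E B C) + measure M (E A C)"
        using measure_Un_le[of "E A B" M "E B C"] measure_Un_le[of "E A B \<union> E B C" M "E A C"] E
        by (auto dest!: fmeasurableD)
      also have "\<dots> = 0" using null by (simp add: null_def E_def)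
      finally have "D Q m = 0" using D_nonneg[of Q m] by linarith
      then show "P = q m" using q_eq Q mF by simp
    qed
    ultimately have "?J = {q m}" by blast
    then show "\<exists>p. ?J = {p}" by blast
  qed
  moreover have "\<forall>A\<in>?F. q A \<in> mspace Z" by (simp add: Zs)
  moreover have "\<forall>A\<in>?F. \<forall>B\<in>?F. mdist Z (q A) (q B) = measure M (sym_diff A B)"
    using D_q by (simp add: Zd D_def)
  ultimately show ?thesis by blast
qed

section \<open>Walls separating two points\<close>

text \<open>
  Membership in \<open>separating\<close> does not depend on which side of the wall is named first.
\<close>

lemma separating_iff:
  assumes "h \<subseteq> S" "x \<in> S" "y \<in> S"
  shows "{h, S - h} \<in> separating S W x y \<longleftrightarrow> {h, S - h} \<in> W \<and> (x \<in> h) \<noteq> (y \<in> h)"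
proof
  assume "{h, S - h} \<in> separating S W x y"
  then obtain k where k: "{h, S - h} \<in> W" "{h, S - h} = {k, S - k}"
    "x \<in> k \<and> y \<in> S - k \<or> y \<in> k \<and> x \<in> S - k"
    unfolding separating_def by blast
  have "h = k \<or> h = S - k" using k(2) by (auto simp: doubleton_eq_iff)
  then show "{h, S - h} \<in> W \<and> (x \<in> h) \<noteq> (y \<in> h)" using k by auto
next
  assume "{h, S - h} \<in> W \<and> (x \<in> h) \<noteq> (y \<in> h)"
  then show "{h, S - h} \<in> separating S W x y"
    unfolding separating_def using assms by blast
qed

lemma separating_sym_diff:
  assumes W: "W \<subseteq> walls S" and S: "x0 \<in> S" "x \<in> S" "y \<in> S"
  shows "sym_diff (separating S W x0 x) (separating S W x0 y) = separating S W x y"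
proof (rule set_eqI)
  fix w
  show "w \<in> sym_diff (separating S W x0 x) (separating S W x0 y) \<longleftrightarrow> w \<in> separating S W x y"
  proof (cases "w \<in> W")
    case True
    then obtain h where h: "h \<subseteq> S" "w = {h, S - h}" using W by (auto simp: walls_def)
    show ?thesis
      unfolding h(2) Un_iff Diff_iff separating_iff[OF h(1) S(1,2)] separating_iff[OF h(1) S(1,3)]
        separating_iff[OF h(1) S(2,3)] by blast
  qed (simp add: separating_def)
qed

lemma measured_walls_imp_submedian:
  fixes X :: "'a metric"
  assumes M: "measured_walls (mspace X) M"
    and dist: "\<forall>x \<in> mspace X. \<forall>y \<in> mspace X. mdist X x y = wall_dist (mspace X) M x y"
  shows "submedian X"
proof -
  let ?S = "mspace X"
  obtain Z :: "'a set set set metric" and q where Z: "median_space Z"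
    "\<forall>A\<in>fmeasurable M. q A \<in> mspace Z"
    "\<forall>A\<in>fmeasurable M. \<forall>B\<in>fmeasurable M. mdist Z (q A) (q B) = measure M (sym_diff A B)"
    using finite_measure_sets_median[of M] by (elim exE conjE) (rule that)
  \<comment> \<open>If the space is empty, \<open>x0\<close> is arbitrary and never used.\<close>
  define x0 where "x0 = (SOME x. x \<in> ?S)"
  have x0: "x0 \<in> ?S" if "x \<in> ?S" for x using someI[of "\<lambda>x. x \<in> ?S" x] that by (simp add: x0_def)
  define s where "s x = separating ?S (space M) x0 x" for x
  have W: "space M \<subseteq> walls ?S" using M by (simp add: measured_walls_def)
  have s: "s x \<in> fmeasurable M" if "x \<in> ?S" for x
    using M that x0[OF that] by (simp add: measured_walls_def s_def fmeasurable_def)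
  have "isometric_embedding X Z (\<lambda>x. q (s x))"
    unfolding isometric_embedding_def
  proof (intro conjI ballI funcsetI)
    show "q (s x) \<in> mspace Z" if "x \<in> ?S" for x using Z(2) s that by blast
    fix x y assume xy: "x \<in> ?S" "y \<in> ?S"
    have "mdist Z (q (s x)) (q (s y)) = measure M (sym_diff (s x) (s y))" using Z(3) s xy by blast
    also have "sym_diff (s x) (s y) = separating ?S (space M) x y"
      unfolding s_def by (rule separating_sym_diff[OF W x0[OF xy(1)] xy])
    also have "measure M \<dots> = mdist X x y" using dist xy by (simp add: wall_dist_def)
    finally show "mdist Z (q (s x)) (q (s y)) = mdist X x y" .
  qed
  with Z(1) show ?thesis by (rule submedianI_any_type)
qed

section \<open>Restricting half-spaces to an isometrically embedded subspace\<close>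

lemma metric_convex_vimage:
  assumes f: "isometric_embedding X Y f" and h: "metric_convex Y h"
  shows "metric_convex X {x \<in> mspace X. f x \<in> h}"
  unfolding metric_convex_def
proof (intro conjI ballI subsetI)
  fix a b z
  assume ab: "a \<in> {x \<in> mspace X. f x \<in> h}" "b \<in> {x \<in> mspace X. f x \<in> h}"
    and z: "z \<in> metric_interval X a b"
  have S: "a \<in> mspace X" "b \<in> mspace X" "z \<in> mspace X" "f a \<in> h" "f b \<in> h"
    using ab z by (auto simp: metric_interval_def)
  have "f z \<in> metric_interval Y (f a) (f b)"
    using f z S by (auto simp: isometric_embedding_def metric_interval_def)
  then have "f z \<in> h" using h S(4,5) unfolding metric_convex_def by (meson subsetD)
  then show "z \<in> {x \<in> mspace X. f x \<in> h}" using S by simp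
qed auto

lemma (in pointed_median_metric) convex_measured_walls_of_embedding:
  assumes f: "isometric_embedding X Y f"
  shows "\<exists>M. measured_walls (mspace X) M \<and>
    (\<forall>x \<in> mspace X. \<forall>y \<in> mspace X. mdist X x y = wall_dist (mspace X) M x y) \<and>
    (\<forall>w \<in> space M. convex_wall X w)"
proof -
  let ?S = "mspace X"
  have fS: "f x \<in> S" if "x \<in> ?S" for x using f that by (auto simp: isometric_embedding_def)
  have fd: "d (f x) (f y) = mdist X x y" if "x \<in> ?S" "y \<in> ?S" for x y
    using f that by (simp add: isometric_embedding_def)
  obtain N where spN: "space N = halfspaces"
    and N: "\<forall>a\<in>S. \<forall>b\<in>S. {h \<in> halfspaces. (a \<in> h) \<noteq> (b \<in> h)} \<in> sets N \<and>
      emeasure N {h \<in> halfspaces. (a \<in> h) \<noteq> (b \<in> h)} = ennreal (d a b)"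
    using halfspace_measure_exists by (elim exE conjE) (rule that)
  have setsN: "{h \<in> halfspaces. (a \<in> h) \<noteq> (b \<in> h)} \<in> sets N"
    and emN: "emeasure N {h \<in> halfspaces. (a \<in> h) \<noteq> (b \<in> h)} = ennreal (d a b)"
    if "a \<in> S" "b \<in> S" for a b
    using bspec[OF bspec[OF N that(1)] that(2)] by (rule conjunct1, rule conjunct2)
  define trace where "trace h = {x \<in> ?S. f x \<in> h}" for h
  define \<phi> where "\<phi> h = {trace h, ?S - trace h}" for h
  define W where "W = {w. convex_wall X w}"
  have trace: "trace h \<subseteq> ?S" for h by (auto simp: trace_def)
  have \<phi>W: "\<phi> h \<in> W" if "h \<in> halfspaces" for h
  proof -
    have h: "metric_convex Y h" "metric_convex Y (S - h)"
      using that by (simp_all add: halfspaces_def conv_def)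
    have "?S - trace h = {x \<in> ?S. f x \<in> S - h}" using fS by (auto simp: trace_def)
    then have "metric_convex X (trace h)" "metric_convex X (?S - trace h)"
      using metric_convex_vimage[OF f h(1)] metric_convex_vimage[OF f h(2)]
      by (simp_all add: trace_def)
    then have "convex_wall X (\<phi> h)"
      unfolding convex_wall_def \<phi>_def by (intro exI[of _ "trace h"] conjI refl trace)
    then show ?thesis by (simp add: W_def)
  qed
  \<comment> \<open>The push-forward is taken on the coarsest sigma-algebra that contains the sets of separating walls.\<close>
  define G where "G = {separating ?S W x y | x y. x \<in> ?S \<and> y \<in> ?S}"
  have G: "G \<subseteq> Pow W" by (auto simp: G_def separating_def)
  have pre: "\<phi> -` separating ?S W x y \<inter> space N = {h \<in> halfspaces. (f x \<in> h) \<noteq> (f y \<in> h)}"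
    if xy: "x \<in> ?S" "y \<in> ?S" for x y
  proof -
    have "\<phi> h \<in> separating ?S W x y \<longleftrightarrow> (f x \<in> h) \<noteq> (f y \<in> h)" if "h \<in> halfspaces" for h
      using separating_iff[OF trace xy, of h W] \<phi>W[OF that] xy by (simp add: \<phi>_def trace_def)
    then show ?thesis by (intro set_eqI) (auto simp only: spN Int_iff vimage_eq mem_Collect_eq)
  qed
  have \<phi>: "\<phi> \<in> measurable N (sigma W G)"
  proof (rule measurable_measure_of[OF G])
    show "\<phi> \<in> space N \<rightarrow> W" using \<phi>W spN by blast
    fix A assume "A \<in> G"
    then obtain x y where xy: "x \<in> ?S" "y \<in> ?S" and A: "A = separating ?S W x y"
      by (auto simp: G_def)
    show "\<phi> -` A \<inter> space N \<in> sets N"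
      unfolding A pre[OF xy] by (rule setsN[OF fS[OF xy(1)] fS[OF xy(2)]])
  qed
  define M where "M = distr N (sigma W G) \<phi>"
  have spM: "space M = W" using G by (simp add: M_def)
  have sep: "separating ?S W x y \<in> sets (sigma W G)" if "x \<in> ?S" "y \<in> ?S" for x y
    using that G by (auto simp: G_def intro!: sigma_sets.Basic)
  have em: "emeasure M (separating ?S W x y) = ennreal (mdist X x y)" if "x \<in> ?S" "y \<in> ?S" for x y
  proof -
    have "emeasure M (separating ?S W x y) = emeasure N (\<phi> -` separating ?S W x y \<inter> space N)"
      unfolding M_def by (rule emeasure_distr[OF \<phi> sep[OF that]])
    also have "\<dots> = ennreal (d (f x) (f y))"
      unfolding pre[OF that] by (rule emN[OF fS[OF that(1)] fS[OF that(2)]])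
    finally show ?thesis unfolding fd[OF that] .
  qed
  have "measured_walls ?S M"
    unfolding measured_walls_def spM
  proof (intro conjI ballI)
    show "W \<subseteq> walls ?S" unfolding W_def walls_def convex_wall_def by (intro Collect_mono) blast
    fix x y assume xy: "x \<in> ?S" "y \<in> ?S"
    show "separating ?S W x y \<in> sets M" using sep[OF xy] by (simp add: M_def)
    show "emeasure M (separating ?S W x y) < \<infinity>" using em[OF xy] by simp
  qed
  moreover have "\<forall>x\<in>?S. \<forall>y\<in>?S. mdist X x y = wall_dist ?S M x y"
    using em by (simp add: wall_dist_def spM measure_def)
  moreover have "\<forall>w\<in>space M. convex_wall X w" by (simp add: spM W_def)
  ultimately show ?thesis by (intro exI[of _ M] conjI)
qed

lemma submedian_imp_convex_measured_walls:
  fixes X :: "'a metric"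
  assumes "submedian X"
  shows "\<exists>M. measured_walls (mspace X) M \<and>
    (\<forall>x \<in> mspace X. \<forall>y \<in> mspace X. mdist X x y = wall_dist (mspace X) M x y) \<and>
    (\<forall>w \<in> space M. convex_wall X w)"
proof (cases "mspace X = {}")
  case True
  then have "measured_walls (mspace X) (count_space {})" by (simp add: measured_walls_def)
  with True show ?thesis by (intro exI[of _ "count_space {}"]) simp
next
  case False
  then obtain s where s: "s \<in> mspace X" by blast
  obtain Y :: "'a median_term metric" and f where Y: "median_space Y" "isometric_embedding X Y f"
    using assms by (auto simp: submedian_def)
  have "f s \<in> mspace Y" using Y(2) s by (auto simp: isometric_embedding_def)
  then interpret pointed_median_metric Y "f s"
    using Y(1) by unfold_locales
  show ?thesis by (rule convex_measured_walls_of_embedding[OF Y(2)])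
qed

theorem corollary5p4:
  fixes X :: "'a metric"
  shows "(submedian X \<longleftrightarrow>
            (\<exists>M. measured_walls (mspace X) M \<and>
                 (\<forall>x \<in> mspace X. \<forall>y \<in> mspace X. mdist X x y = wall_dist (mspace X) M x y)))
       \<and> (submedian X \<longrightarrow>
            (\<exists>M. measured_walls (mspace X) M \<and>
                 (\<forall>x \<in> mspace X. \<forall>y \<in> mspace X. mdist X x y = wall_dist (mspace X) M x y) \<and>
                 (\<forall>w \<in> space M. convex_wall X w)))"
  using measured_walls_imp_submedian[of X] submedian_imp_convex_measured_walls[of X] by blast

end
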